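(* Let $a,c\in\mathcal E_n$ and $b,d\in\pm\mathcal E_n$ be such that $(a,b)$ and $(c,d)$ are zero divisors in $\mathcal A_{n+1}$ and $(a,b)(c,d)=0$. Then $ab=cd$ or $ab=-cd$.
   Context: Real Cayley–Dickson algebras: $\mathcal A_0=\mathbb R$ with trivial involution. Given parameters $\gamma_0,\gamma_1,\dots\in\{\pm1\}$ (the paper's normalization of nonzero real parameters), $\mathcal A_{k+1}=\mathcal A_k\times\mathcal A_k$ with componentwise addition and real scaling, product $(a,b)(c,d)=(ac+\gamma_k\bar d b,\ da+b\bar c)$ and involution $\overline{(a,b)}=(\bar a,-b)$. Standard basis: $e^{(0)}_0=1$; $e^{(k+1)}_j=(e^{(k)}_j,0)$ for $0\le j<2^k$ and $e^{(k+1)}_j=(0,e^{(k)}_{j-2^k})$ for $2^k\le j<2^{k+1}$. $\mathcal E_n=\{e^{(n)}_0,\dots,e^{(n)}_{2^n-1}\}$ and $\pm\mathcal E_n=\mathcal E_n\cup(-\mathcal E_n)$. A zero divisor is a nonzero $x$ such that $xy=0$ or $yx=0$ for some $y\neq0$. *)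

theory Defs
  imports Complex_Main
begin

text \<open>
  The algebras \<open>A\<^sub>0 = \<real>\<close>, \<open>A\<^sub>k\<^sub>+\<^sub>1 = A\<^sub>k \<times> A\<^sub>k\<close> have a type depending on \<open>k\<close>.  All of them
  are embedded into one type of nested pairs of reals; \<open>A\<^sub>k\<close> is the set of pairs nested to
  uniform depth \<open>k\<close>.  On arguments outside the relevant \<open>A\<^sub>k\<close> the operations are meaningless.
\<close>

datatype cd = CD_Real real | CD_Pair cd cd

primrec cd_carrier :: "nat \<Rightarrow> cd set" where
  "cd_carrier 0 = range CD_Real"
| "cd_carrier (Suc k) = {CD_Pair a b | a b. a \<in> cd_carrier k \<and> b \<in> cd_carrier k}"

primrec cd_zero :: "nat \<Rightarrow> cd" where
  "cd_zero 0 = CD_Real 0"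
| "cd_zero (Suc k) = CD_Pair (cd_zero k) (cd_zero k)"

fun cd_add :: "cd \<Rightarrow> cd \<Rightarrow> cd" where
  "cd_add (CD_Real x) (CD_Real y) = CD_Real (x + y)"
| "cd_add (CD_Pair a b) (CD_Pair c d) = CD_Pair (cd_add a c) (cd_add b d)"

primrec cd_scale :: "real \<Rightarrow> cd \<Rightarrow> cd" where
  "cd_scale r (CD_Real x) = CD_Real (r * x)"
| "cd_scale r (CD_Pair a b) = CD_Pair (cd_scale r a) (cd_scale r b)"

definition cd_neg :: "cd \<Rightarrow> cd" where
  "cd_neg x = cd_scale (- 1) x"

primrec cd_conj :: "cd \<Rightarrow> cd" where
  "cd_conj (CD_Real x) = CD_Real x"
| "cd_conj (CD_Pair a b) = CD_Pair (cd_conj a) (cd_neg b)"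

text \<open>\<open>cd_mult \<gamma> k\<close> is the product of \<open>A\<^sub>k\<close>, which uses the parameters \<open>\<gamma> 0, \<dots>, \<gamma> (k - 1)\<close>.\<close>

fun cd_mult :: "(nat \<Rightarrow> real) \<Rightarrow> nat \<Rightarrow> cd \<Rightarrow> cd \<Rightarrow> cd" where
  "cd_mult \<gamma> 0 (CD_Real x) (CD_Real y) = CD_Real (x * y)"
| "cd_mult \<gamma> (Suc k) (CD_Pair a b) (CD_Pair c d) =
     CD_Pair
       (cd_add (cd_mult \<gamma> k a c) (cd_scale (\<gamma> k) (cd_mult \<gamma> k (cd_conj d) b)))
       (cd_add (cd_mult \<gamma> k d a) (cd_mult \<gamma> k b (cd_conj c)))"

text \<open>\<open>cd_unit k j\<close> is the standard basis element \<open>e\<^sub>j\<close> of \<open>A\<^sub>k\<close>, for \<open>j < 2 ^ k\<close>.\<close>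

primrec cd_unit :: "nat \<Rightarrow> nat \<Rightarrow> cd" where
  "cd_unit 0 j = CD_Real 1"
| "cd_unit (Suc k) j =
     (if j < 2 ^ k then CD_Pair (cd_unit k j) (cd_zero k)
      else CD_Pair (cd_zero k) (cd_unit k (j - 2 ^ k)))"

definition cd_basis :: "nat \<Rightarrow> cd set" where
  "cd_basis n = {cd_unit n j | j. j < 2 ^ n}"

definition cd_signed_basis :: "nat \<Rightarrow> cd set" where
  "cd_signed_basis n = cd_basis n \<union> cd_neg ` cd_basis n"

definition cd_zero_divisor :: "(nat \<Rightarrow> real) \<Rightarrow> nat \<Rightarrow> cd \<Rightarrow> bool" where
  "cd_zero_divisor \<gamma> n x \<longleftrightarrow>
     x \<in> cd_carrier n \<and> x \<noteq> cd_zero n \<and>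
     (\<exists>y \<in> cd_carrier n. y \<noteq> cd_zero n \<and>
        (cd_mult \<gamma> n x y = cd_zero n \<or> cd_mult \<gamma> n y x = cd_zero n))"

lemma cd_zero_carrier: "cd_zero k \<in> cd_carrier k"
  by (induction k) auto

lemma cd_add_carrier:
  "x \<in> cd_carrier k \<Longrightarrow> y \<in> cd_carrier k \<Longrightarrow> cd_add x y \<in> cd_carrier k"
  by (induction k arbitrary: x y) auto

lemma cd_scale_carrier: "x \<in> cd_carrier k \<Longrightarrow> cd_scale r x \<in> cd_carrier k"
  by (induction k arbitrary: x) auto

lemma cd_neg_carrier: "x \<in> cd_carrier k \<Longrightarrow> cd_neg x \<in> cd_carrier k"
  by (simp add: cd_neg_def cd_scale_carrier)

lemma cd_conj_carrier: "x \<in> cd_carrier k \<Longrightarrow> cd_conj x \<in> cd_carrier k"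
  by (induction k arbitrary: x) (auto simp: cd_neg_carrier)

lemma cd_mult_carrier:
  "x \<in> cd_carrier k \<Longrightarrow> y \<in> cd_carrier k \<Longrightarrow> cd_mult \<gamma> k x y \<in> cd_carrier k"
  by (induction k arbitrary: x y)
    (auto simp: cd_add_carrier cd_scale_carrier cd_conj_carrier)

lemma cd_unit_carrier: "cd_unit k j \<in> cd_carrier k"
  by (induction k arbitrary: j) (auto simp: cd_zero_carrier)

end

theory Submission
  imports Defs
begin

text \<open>
  Up to sign, multiplication of basis elements is addition of exponents in \<open>(\<int>/2)\<^sup>n\<close>.  The first
  component of \<open>(a, b)(c, d) = 0\<close> says that \<open>ac\<close> and \<open>\<plusminus>\<close>(conjugate of \<open>d\<close>)\<open>b\<close> agree up to sign, so
  \<open>a + c = d + b\<close> on exponents.  In characteristic 2 this is \<open>a + b = c + d\<close>, i.e.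
  \<open>ab = \<plusminus>cd\<close>.
\<close>

text \<open>
  \<open>cd_line k v\<close> consists of the two signs of the basis element of \<open>A\<^sub>k\<close> whose index has the
  binary digits \<open>v 0, \<dots>, v (k - 1)\<close>.
\<close>

primrec cd_line :: "nat \<Rightarrow> (nat \<Rightarrow> bool) \<Rightarrow> cd set" where
  "cd_line 0 v = {CD_Real 1, CD_Real (- 1)}"
| "cd_line (Suc k) v =
     (if v k then CD_Pair (cd_zero k) ` cd_line k v
      else (\<lambda>x. CD_Pair x (cd_zero k)) ` cd_line k v)"

lemma cd_scale_zero: "cd_scale r (cd_zero k) = cd_zero k"
  by (induction k) auto

lemma cd_neg_zero: "cd_neg (cd_zero k) = cd_zero k"
  by (simp add: cd_neg_def cd_scale_zero)

lemma cd_conj_zero: "cd_conj (cd_zero k) = cd_zero k"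
  by (induction k) (auto simp: cd_neg_zero)

lemma cd_scale_one: "cd_scale 1 x = x"
  by (induction x) auto

lemma cd_neg_Pair: "cd_neg (CD_Pair x y) = CD_Pair (cd_neg x) (cd_neg y)"
  by (simp add: cd_neg_def)

lemma cd_add_zero_left: "x \<in> cd_carrier k \<Longrightarrow> cd_add (cd_zero k) x = x"
  by (induction k arbitrary: x) auto

lemma cd_add_zero_right: "x \<in> cd_carrier k \<Longrightarrow> cd_add x (cd_zero k) = x"
  by (induction k arbitrary: x) auto

lemma cd_mult_zero:
  assumes "x \<in> cd_carrier k"
  shows "cd_mult \<gamma> k (cd_zero k) x = cd_zero k" "cd_mult \<gamma> k x (cd_zero k) = cd_zero k"
  using assms
  by (induction k arbitrary: x)
    (auto simp: cd_conj_zero cd_conj_carrier cd_scale_zero cd_add_zero_left cd_zero_carrier)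

lemma cd_add_eq_zero:
  "x \<in> cd_carrier k \<Longrightarrow> y \<in> cd_carrier k \<Longrightarrow> cd_add x y = cd_zero k \<Longrightarrow> x = cd_neg y"
  by (induction k arbitrary: x y) (auto simp: cd_neg_def)

lemma cd_line_carrier: "x \<in> cd_line k v \<Longrightarrow> x \<in> cd_carrier k"
  by (induction k arbitrary: x) (auto simp: cd_zero_carrier split: if_splits)

lemma cd_line_nonzero: "cd_zero k \<notin> cd_line k v"
  by (induction k) auto

lemma cd_line_neg: "x \<in> cd_line k v \<Longrightarrow> cd_neg x \<in> cd_line k v"
proof (induction k arbitrary: x)
  case 0
  then show ?case by (auto simp: cd_neg_def)
next
  case (Suc k)
  then show ?case by (auto simp: cd_neg_Pair cd_neg_zero split: if_splits)
qed

text \<open>Absorbs the factor \<open>\<gamma> k\<close> of the product. A line is closed only under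
  change of sign, so this is where the normalization to 1 and -1 enters.\<close>

lemma cd_line_scale:
  "r \<in> {1, - 1} \<Longrightarrow> x \<in> cd_line k v \<Longrightarrow> cd_scale r x \<in> cd_line k v"
  using cd_line_neg[of x k v] by (auto simp: cd_neg_def cd_scale_one)

lemma cd_line_conj: "x \<in> cd_line k v \<Longrightarrow> cd_conj x \<in> cd_line k v"
  by (induction k arbitrary: x) (auto simp: cd_neg_zero cd_conj_zero cd_line_neg split: if_splits)

lemma cd_line_cong: "(\<And>i. i < k \<Longrightarrow> u i = v i) \<Longrightarrow> cd_line k u = cd_line k v"
  by (induction k) auto

text \<open>Converts agreement of exponents back into the equality up to sign that the theorem
  asserts.\<close>

lemma cd_line_eq_or_neg:
  "x \<in> cd_line k v \<Longrightarrow> y \<in> cd_line k v \<Longrightarrow> x = y \<or> x = cd_neg y"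
proof (induction k arbitrary: x y)
  case 0
  then show ?case by (auto simp: cd_neg_def)
next
  case (Suc k)
  then show ?case by (fastforce simp: cd_neg_Pair cd_neg_zero split: if_splits)
qed

text \<open>The top digit is read off from which half of the pair vanishes. Two different readings
  would make both halves zero, against \<open>cd_line_nonzero\<close>; lower digits follow by
  induction on the other half.\<close>

lemma cd_line_unique:
  "x \<in> cd_line k u \<Longrightarrow> x \<in> cd_line k v \<Longrightarrow> i < k \<Longrightarrow> u i = v i"
proof (induction k arbitrary: x)
  case 0
  then show ?case by simp
next
  case (Suc k)
  then show ?case
    by (cases "i = k") (auto simp: cd_line_nonzero split: if_splits)
qed

lemma cd_line_mult:
  assumes "\<And>k. \<gamma> k \<in> {1, - 1}"
  shows "x \<in> cd_line k u \<Longrightarrow> y \<in> cd_line k v \<Longrightarrow>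
    cd_mult \<gamma> k x y \<in> cd_line k (\<lambda>i. u i \<noteq> v i)"
proof (induction k arbitrary: x y u v)
  case 0
  then show ?case by auto
next
  case (Suc k)
  \<comment> \<open>The product formula also multiplies in the reverse order. Exclusive or is
    symmetric, so those products lie on the same line.\<close>
  have swap: "(\<lambda>i. v i \<noteq> u i) = (\<lambda>i. u i \<noteq> v i)" by auto
  note simps = cd_mult_zero cd_conj_zero cd_scale_zero cd_neg_zero cd_zero_carrier
    cd_add_zero_left cd_add_zero_right cd_line_carrier cd_mult_carrier cd_conj_carrier
    cd_scale_carrier
  obtain x' where x': "x' \<in> cd_line k u"
    "x = (if u k then CD_Pair (cd_zero k) x' else CD_Pair x' (cd_zero k))"
    using Suc.prems(1) by (auto split: if_splits)
  obtain y' where y': "y' \<in> cd_line k v"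
    "y = (if v k then CD_Pair (cd_zero k) y' else CD_Pair y' (cd_zero k))"
    using Suc.prems(2) by (auto split: if_splits)
  \<comment> \<open>Each of \<open>x\<close> and \<open>y\<close> has one zero half, so only one of
    the four terms of the product formula survives. These are the four candidates, one for each
    choice of \<open>u k\<close> and \<open>v k\<close>; the half where the survivor stands gives
    the new top digit.\<close>
  have xy: "cd_mult \<gamma> k x' y' \<in> cd_line k (\<lambda>i. u i \<noteq> v i)"
    "cd_mult \<gamma> k y' x' \<in> cd_line k (\<lambda>i. u i \<noteq> v i)"
    "cd_mult \<gamma> k x' (cd_conj y') \<in> cd_line k (\<lambda>i. u i \<noteq> v i)"
    "cd_scale (\<gamma> k) (cd_mult \<gamma> k (cd_conj y') x') \<in> cd_line k (\<lambda>i. u i \<noteq> v i)"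
    using Suc.IH[OF x'(1) y'(1)] Suc.IH[OF y'(1) x'(1)]
      Suc.IH[OF x'(1) cd_line_conj[OF y'(1)]] Suc.IH[OF cd_line_conj[OF y'(1)] x'(1)]
    by (auto simp only: swap intro!: cd_line_scale assms)
  note carrier = cd_line_carrier[OF x'(1)] cd_line_carrier[OF y'(1)]
  show ?case
    using xy carrier by (cases "u k"; cases "v k") (simp_all add: x'(2) y'(2) simps)
qed

lemma cd_unit_in_line: "\<exists>v. cd_unit k j \<in> cd_line k v"
proof (induction k arbitrary: j)
  case 0
  then show ?case by simp
next
  case (Suc k)
  obtain v where v: "cd_unit k (if j < 2 ^ k then j else j - 2 ^ k) \<in> cd_line k v"
    using Suc by blast
  \<comment> \<open>Digit \<open>k\<close> of \<open>v\<close> is still free, so it can be set to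
    the leading digit of \<open>j\<close>.\<close>
  have "cd_line k (v(k := t)) = cd_line k v" for t
    by (rule cd_line_cong) auto
  with v have "cd_unit (Suc k) j \<in> cd_line (Suc k) (v(k := (j \<ge> 2 ^ k)))"
    by (auto split: if_splits)
  then show ?case by blast
qed

lemma cd_signed_basis_in_line:
  assumes "x \<in> cd_signed_basis n"
  obtains v where "x \<in> cd_line n v"
  using assms cd_unit_in_line[of n] cd_line_neg
  unfolding cd_signed_basis_def cd_basis_def by blast

theorem lemma6p2:
  fixes \<gamma> :: "nat \<Rightarrow> real" and n :: nat and a b c d :: cd
  assumes "\<And>k. \<gamma> k \<in> {1, - 1}"
    and "a \<in> cd_basis n" and "c \<in> cd_basis n"
    and "b \<in> cd_signed_basis n" and "d \<in> cd_signed_basis n"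
    and "cd_zero_divisor \<gamma> (Suc n) (CD_Pair a b)"
    and "cd_zero_divisor \<gamma> (Suc n) (CD_Pair c d)"
    and "cd_mult \<gamma> (Suc n) (CD_Pair a b) (CD_Pair c d) = cd_zero (Suc n)"
  shows "cd_mult \<gamma> n a b = cd_mult \<gamma> n c d \<or> cd_mult \<gamma> n a b = cd_neg (cd_mult \<gamma> n c d)"
proof -
  note mult = cd_line_mult[of \<gamma>, OF assms(1)]
  have "a \<in> cd_signed_basis n" "c \<in> cd_signed_basis n"
    using assms(2,3) by (auto simp: cd_signed_basis_def)
  then obtain p q r s where lines:
    "a \<in> cd_line n p" "b \<in> cd_line n q" "c \<in> cd_line n r" "d \<in> cd_line n s"
    using assms(4,5) by (metis cd_signed_basis_in_line)
  let ?y = "cd_scale (\<gamma> n) (cd_mult \<gamma> n (cd_conj d) b)"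
  have ac: "cd_mult \<gamma> n a c \<in> cd_line n (\<lambda>i. p i \<noteq> r i)"
    using mult lines by blast
  have db: "?y \<in> cd_line n (\<lambda>i. s i \<noteq> q i)"
    by (intro cd_line_scale mult cd_line_conj lines assms(1))
  have "cd_add (cd_mult \<gamma> n a c) ?y = cd_zero n"
    using assms(8) by simp
  then have "cd_mult \<gamma> n a c = cd_neg ?y"
    using ac db by (blast intro: cd_add_eq_zero cd_line_carrier)
  then have "cd_mult \<gamma> n a c \<in> cd_line n (\<lambda>i. s i \<noteq> q i)"
    using cd_line_neg[OF db] by simp
  \<comment> \<open>The product of \<open>a\<close> and \<open>c\<close> now lies on two lines,
    which must share their digits below \<open>n\<close>.\<close>
  then have "(p i \<noteq> r i) = (s i \<noteq> q i)" if "i < n" for i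
    using cd_line_unique[OF ac _ that] by simp
  then have "cd_line n (\<lambda>i. p i \<noteq> q i) = cd_line n (\<lambda>i. r i \<noteq> s i)"
    by (intro cd_line_cong) blast
  then have "cd_mult \<gamma> n a b \<in> cd_line n (\<lambda>i. r i \<noteq> s i)"
    using mult[OF lines(1,2)] by simp
  then show ?thesis
    using cd_line_eq_or_neg mult[OF lines(3,4)] by blast
qed

end
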